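(* The edge Folkman number $F_e(K_3,K_3;K_1+P_4)$ does not exist; that is, for every $(K_1+P_4)$-free graph $G$ there is a red-blue coloring of the edges of $G$ with no monochromatic triangle.
   Context: All graphs are finite, undirected and simple. $P_4$ is the path on $4$ vertices; the join $K_1+P_4$ is obtained by adding a vertex adjacent to all vertices of $P_4$. A graph is $H$-free if it contains no subgraph isomorphic to $H$. $F_e(K_3,K_3;H)$ is the smallest $n$ such that some $H$-free graph on $n$ vertices has every red-blue edge coloring containing a monochromatic $K_3$; it "exists" if such a graph exists. *)

theory Defs
  imports Main
begin

record 'a ugraph =
  verts :: "'a set"
  edges :: "'a set set"

definition simple_graph :: "'a ugraph \<Rightarrow> bool" where
  "simple_graph G \<longleftrightarrow> finite (verts G) \<and> (\<forall>e \<in> edges G. e \<subseteq> verts G \<and> card e = 2)"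

definition subgraph_of :: "'a ugraph \<Rightarrow> 'a ugraph \<Rightarrow> bool" where
  "subgraph_of S G \<longleftrightarrow> simple_graph S \<and> verts S \<subseteq> verts G \<and> edges S \<subseteq> edges G"

definition graph_iso :: "'a ugraph \<Rightarrow> 'b ugraph \<Rightarrow> bool" where
  "graph_iso G H \<longleftrightarrow> (\<exists>f. bij_betw f (verts G) (verts H) \<and>
     (\<forall>u \<in> verts G. \<forall>v \<in> verts G. {u, v} \<in> edges G \<longleftrightarrow> {f u, f v} \<in> edges H))"

(* Subgraphs are not required to be induced. *)
definition contains_copy :: "'a ugraph \<Rightarrow> 'b ugraph \<Rightarrow> bool" where
  "contains_copy G H \<longleftrightarrow> (\<exists>S. subgraph_of S G \<and> graph_iso S H)"

definition graph_free :: "'b ugraph \<Rightarrow> 'a ugraph \<Rightarrow> bool" where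
  "graph_free H G \<longleftrightarrow> \<not> contains_copy G H"

definition complete_graph :: "nat \<Rightarrow> nat ugraph" where
  "complete_graph n = \<lparr> verts = {..<n}, edges = {{i, j} | i j. i < n \<and> j < n \<and> i \<noteq> j} \<rparr>"

definition path_graph :: "nat \<Rightarrow> nat ugraph" where
  "path_graph n = \<lparr> verts = {..<n}, edges = {{i, Suc i} | i. Suc i < n} \<rparr>"

definition graph_join :: "'a ugraph \<Rightarrow> 'b ugraph \<Rightarrow> ('a + 'b) ugraph" where
  "graph_join G H =
     \<lparr> verts = verts G <+> verts H,
       edges = ((`) Inl) ` edges G \<union> ((`) Inr) ` edges H
               \<union> {{Inl u, Inr v} | u v. u \<in> verts G \<and> v \<in> verts H} \<rparr>"

datatype color = Red | Blue

(* An edge coloring of G is a function on all vertex sets of which only the values on edges G matter. *)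
definition color_class :: "'a ugraph \<Rightarrow> ('a set \<Rightarrow> color) \<Rightarrow> color \<Rightarrow> 'a ugraph" where
  "color_class G c x = \<lparr> verts = verts G, edges = {e \<in> edges G. c e = x} \<rparr>"

definition edge_arrows :: "'a ugraph \<Rightarrow> 'b ugraph \<Rightarrow> 'c ugraph \<Rightarrow> bool" where
  "edge_arrows G H1 H2 \<longleftrightarrow>
     (\<forall>c. contains_copy (color_class G c Red) H1 \<or> contains_copy (color_class G c Blue) H2)"

(* Every finite graph is isomorphic to one with natural-number vertices,
   so fixing the vertex type here loses no generality. *)
definition folkman_order :: "'b ugraph \<Rightarrow> 'c ugraph \<Rightarrow> 'd ugraph \<Rightarrow> nat \<Rightarrow> bool" where
  "folkman_order H1 H2 H n \<longleftrightarrow>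
     (\<exists>G :: nat ugraph. simple_graph G \<and> card (verts G) = n \<and> graph_free H G \<and> edge_arrows G H1 H2)"

(* F_e(H1, H2; H); the value None means that the number does not exist. *)
definition edge_folkman :: "'b ugraph \<Rightarrow> 'c ugraph \<Rightarrow> 'd ugraph \<Rightarrow> nat option" where
  "edge_folkman H1 H2 H =
     (if \<exists>n. folkman_order H1 H2 H n then Some (LEAST n. folkman_order H1 H2 H n) else None)"

end

theory Submission
  imports Defs
begin

text \<open>
  Take a maximal set \<open>B\<close> of edges such that no triangle contains two edges of \<open>B\<close>, and colour the
  edges of \<open>B\<close> blue and all others red. Suppose that a triangle \<open>abc\<close> contains no edge of \<open>B\<close>.
  By maximality every edge of \<open>abc\<close> lies in a further triangle that contains an edge of \<open>B\<close>. Two of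
  these triangles with different apices \<open>d\<close>, \<open>e\<close>, say \<open>abd\<close> and \<open>ace\<close>, would give a path
  \<open>d b c e\<close> in the neighbourhood of \<open>a\<close>; hence all three have the same apex \<open>d\<close>. Then at least two
  of the edges \<open>ad\<close>, \<open>bd\<close>, \<open>cd\<close> are in \<open>B\<close>, and they lie in a common triangle, a contradiction.
\<close>

text \<open>A copy need not be induced: \<open>S\<close> keeps only the images of edges of
  \<open>H\<close>, whatever other edges \<open>G\<close> has between these vertices.\<close>

lemma contains_copyI:
  assumes H: "simple_graph H"
    and inj: "inj_on g (verts H)"
    and vs: "g ` verts H \<subseteq> verts G"
    and es: "\<And>e. e \<in> edges H \<Longrightarrow> g ` e \<in> edges G"
  shows "contains_copy G H"
proof -
  define S where "S = \<lparr>verts = g ` verts H, edges = (`) g ` edges H\<rparr>"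
  have sub: "e \<subseteq> verts H" if "e \<in> edges H" for e
    using H that by (auto simp: simple_graph_def)
  have "simple_graph S"
    using H inj by (auto simp: simple_graph_def S_def card_image inj_on_subset)
  then have "subgraph_of S G"
    using vs es by (auto simp: subgraph_of_def S_def)
  moreover have "graph_iso S H"
    unfolding graph_iso_def
  proof (intro exI conjI ballI)
    show "bij_betw (inv_into (verts H) g) (verts S) (verts H)"
      using inj by (simp add: S_def bij_betw_inv_into inj_on_imp_bij_betw)
    fix u v assume "u \<in> verts S" "v \<in> verts S"
    then obtain x y where xy: "x \<in> verts H" "y \<in> verts H" "u = g x" "v = g y"
      by (auto simp: S_def)
    \<comment> \<open>An edge of \<open>S\<close> is the image of some edge \<open>e\<close> of
      \<open>H\<close>; injectivity of \<open>g\<close> on vertices forces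
      \<open>e = {x, y}\<close>.\<close>
    have "{x, y} \<in> edges H" if "e \<in> edges H" "g ` {x, y} = g ` e" for e
      using inj_on_image_eq_iff[OF inj, of "{x, y}" e] sub that xy by auto
    then have "g ` {x, y} \<in> edges S \<longleftrightarrow> {x, y} \<in> edges H"
      using imageI[of "{x, y}" "edges H" "(`) g"] unfolding S_def by auto
    then show "{u, v} \<in> edges S \<longleftrightarrow>
        {inv_into (verts H) g u, inv_into (verts H) g v} \<in> edges H"
      using inj xy by simp
  qed
  ultimately show ?thesis
    by (auto simp: contains_copy_def)
qed

lemma contains_triangleD:
  assumes "contains_copy G (complete_graph 3)"
  obtains a b c where "{a, b} \<in> edges G" "{a, c} \<in> edges G" "{b, c} \<in> edges G"
proof -
  obtain S f where S: "subgraph_of S G"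
    and f: "bij_betw f (verts S) {..<3::nat}"
    and iso: "\<And>u v. u \<in> verts S \<Longrightarrow> v \<in> verts S \<Longrightarrow>
      {u, v} \<in> edges S \<longleftrightarrow> {f u, f v} \<in> edges (complete_graph 3)"
    using assms by (auto simp: contains_copy_def graph_iso_def complete_graph_def)
  define g where "g = inv_into (verts S) f"
  have g: "g i \<in> verts S" "f (g i) = i" if "i < 3" for i
    using that f unfolding g_def
    by (auto simp: bij_betw_def inv_into_into f_inv_into_f)
  have "{g i, g j} \<in> edges G" if "i < 3" "j < 3" "i \<noteq> j" for i j
  proof -
    have "{i, j} \<in> edges (complete_graph 3)"
      using that by (auto simp: complete_graph_def)
    then have "{g i, g j} \<in> edges S"
      using iso g that by simp
    then show ?thesis
      using S by (auto simp: subgraph_of_def)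
  qed
  then show thesis
    using that[of "g 0" "g 1" "g 2"] by simp
qed

lemma simple_graph_edge_neq:
  assumes "simple_graph G" "{u, v} \<in> edges G"
  shows "u \<noteq> v"
  using assms by (force simp: simple_graph_def)

lemma simple_graph_fan: "simple_graph (graph_join (complete_graph 1) (path_graph 4))"
proof -
  have "finite (verts (graph_join (complete_graph 1) (path_graph 4)))"
    by (simp add: graph_join_def complete_graph_def path_graph_def)
  then show ?thesis
    by (auto simp: simple_graph_def graph_join_def complete_graph_def path_graph_def)
qed

text \<open>Hub \<open>v\<close> and path \<open>p q r s\<close> give the forbidden fan once the
  five vertices are distinct. Adjacent vertices differ and \<open>neq\<close> settles two more
  pairs, so \<open>p = s\<close> is the only coincidence left.\<close>

lemma no_path_in_neighborhood:
  assumes G: "simple_graph G"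
    and free: "graph_free (graph_join (complete_graph 1) (path_graph 4)) G"
    and nb: "{v, p} \<in> edges G" "{v, q} \<in> edges G" "{v, r} \<in> edges G" "{v, s} \<in> edges G"
    and path: "{p, q} \<in> edges G" "{q, r} \<in> edges G" "{r, s} \<in> edges G"
    and neq: "p \<noteq> r" "q \<noteq> s"
  shows "p = s"
proof (rule ccontr)
  assume ps: "p \<noteq> s"
  let ?H = "graph_join (complete_graph 1) (path_graph 4)"
  let ?xs = "[p, q, r, s]"
  have dist: "distinct ?xs" "v \<notin> set ?xs"
    using ps neq simple_graph_edge_neq[OF G] nb path by auto
  have verts: "v \<in> verts G" "set ?xs \<subseteq> verts G"
    using G nb by (auto simp: simple_graph_def)
  define h where "h = (!) ?xs"
  have h: "h 0 = p" "h 1 = q" "h 2 = r" "h 3 = s"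
    by (simp_all add: h_def)
  have h_inj: "inj_on h {..<4}"
    unfolding h_def by (rule inj_on_nth[OF dist(1)]) simp
  have h_in: "h i \<in> set ?xs" if "i < 4" for i
    using that unfolding h_def by (intro nth_mem) simp
  define g :: "nat + nat \<Rightarrow> _" where "g = case_sum (\<lambda>_. v) h"
  have vH: "verts ?H = insert (Inl 0) (Inr ` {..<4})"
    by (auto simp: graph_join_def complete_graph_def path_graph_def)
  have "contains_copy G ?H"
  proof (rule contains_copyI[OF simple_graph_fan])
    have img: "g ` Inr ` {..<4} \<subseteq> set ?xs"
      using h_in by (simp only: image_subset_iff g_def) simp
    have "inj_on g (Inr ` {..<4})"
      using h_inj by (simp add: inj_on_def g_def)
    moreover have "g (Inl 0) \<notin> g ` Inr ` {..<4}"
      using img dist(2) by (auto simp only: g_def sum.case)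
    ultimately show "inj_on g (verts ?H)"
      unfolding vH by (simp add: inj_on_insert image_iff)
    show "g ` verts ?H \<subseteq> verts G"
      unfolding vH using subset_trans[OF img verts(2)] verts(1)
      by (simp only: image_insert insert_subset) (simp add: g_def)
    fix e assume "e \<in> edges ?H"
    \<comment> \<open>The one-vertex graph has no edges, so only path edges and spokes
      remain.\<close>
    then consider (path) i where "Suc i < 4" "e = {Inr i, Inr (Suc i)}"
      | (spoke) i where "i < 4" "e = {Inl 0, Inr i}"
      unfolding graph_join_def complete_graph_def path_graph_def
      by (simp, elim disjE imageE exE conjE CollectE; simp)
    then show "g ` e \<in> edges G"
    proof cases
      case path
      then have "i = 0 \<or> i = 1 \<or> i = 2" by auto
      then show ?thesis using path assms(7-9) h by (auto simp: g_def numeral_2_eq_2 numeral_3_eq_3)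
    next
      case spoke
      then have "i = 0 \<or> i = 1 \<or> i = 2 \<or> i = 3" by auto
      then show ?thesis using spoke nb h by (auto simp: g_def)
    qed
  qed
  then show False
    using free by (simp add: graph_free_def)
qed

text \<open>Any two edges of a triangle share a vertex, here \<open>a\<close>, so this says that no
  triangle has two edges in \<open>B\<close>. The case \<open>b = c\<close> is harmless: a simple
  graph has no edge \<open>{b, b}\<close>.\<close>

definition thin :: "'a ugraph \<Rightarrow> 'a set set \<Rightarrow> bool" where
  "thin G B \<longleftrightarrow> B \<subseteq> edges G \<and>
     (\<forall>a b c. {a, b} \<in> B \<longrightarrow> {a, c} \<in> B \<longrightarrow> {b, c} \<notin> edges G)"

text \<open>There are finitely many sets of edges, so some thin set is maximal under inclusion.
  Maximality is recorded for adding one edge, the form used below.\<close>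

lemma maximal_thin_exists:
  assumes "simple_graph G"
  obtains B where "thin G B" "\<And>e. thin G (insert e B) \<Longrightarrow> e \<in> B"
proof -
  have "edges G \<subseteq> Pow (verts G)" "finite (verts G)"
    using assms by (auto simp: simple_graph_def)
  then have "finite (edges G)"
    by (meson finite_Pow_iff finite_subset)
  then have "finite {B. thin G B}"
    by (rule finite_subset[rotated, OF finite_Pow_iff[THEN iffD2]]) (auto simp: thin_def)
  moreover have "{} \<in> {B. thin G B}"
    by (simp add: thin_def)
  ultimately obtain B where "thin G B" "\<forall>C. thin G C \<longrightarrow> B \<subseteq> C \<longrightarrow> B = C"
    using finite_has_maximal[of "{B. thin G B}"] by auto
  then show thesis
    using that[of B] by blast
qed

lemma not_thin_insertD:
  assumes G: "simple_graph G"
    and thin: "thin G B" and ab: "{a, b} \<in> edges G" and not_thin: "\<not> thin G (insert {a, b} B)"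
  obtains d where "{a, d} \<in> edges G" "{b, d} \<in> edges G" "{a, d} \<in> B \<or> {b, d} \<in> B"
proof -
  obtain x y z where xyz: "{x, y} \<in> insert {a, b} B" "{x, z} \<in> insert {a, b} B" "{y, z} \<in> edges G"
    using thin ab not_thin unfolding thin_def by blast
  have neq: "y \<noteq> z"
    using simple_graph_edge_neq[OF G xyz(3)] .
  have no: "\<not> ({x, y} \<in> B \<and> {x, z} \<in> B)" and sub: "B \<subseteq> edges G"
    using thin xyz(3) by (auto simp: thin_def)
  \<comment> \<open>The violation must use the new edge, as \<open>B\<close> is thin, and cannot use
    it twice, as then \<open>y = z\<close>. So one of its two edges is \<open>{a, b}\<close> and the
    other is in \<open>B\<close>; the vertex outside \<open>{a, b}\<close> becomes
    \<open>d\<close>.\<close>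
  consider "{x, y} = {a, b}" "{x, z} \<in> B" | "{x, z} = {a, b}" "{x, y} \<in> B"
    using no xyz neq by (auto simp: doubleton_eq_iff)
  then show thesis
  proof cases
    case 1
    then show thesis
      using that[of z] xyz(3) sub by (auto simp: doubleton_eq_iff)
  next
    case 2
    then show thesis
      using that[of y] xyz(3) sub by (auto simp: doubleton_eq_iff insert_commute)
  qed
qed

lemma maximal_thin_meets_triangle:
  assumes G: "simple_graph G"
    and free: "graph_free (graph_join (complete_graph 1) (path_graph 4)) G"
    and thin: "thin G B" and max: "\<And>e. thin G (insert e B) \<Longrightarrow> e \<in> B"
    and tri: "{a, b} \<in> edges G" "{a, c} \<in> edges G" "{b, c} \<in> edges G"
  shows "{a, b} \<in> B \<or> {a, c} \<in> B \<or> {b, c} \<in> B"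
proof (rule ccontr)
  assume none: "\<not> ?thesis"
  obtain d where d: "{a, d} \<in> edges G" "{b, d} \<in> edges G" "{a, d} \<in> B \<or> {b, d} \<in> B"
    using not_thin_insertD[OF G thin tri(1)] max none by metis
  obtain e where e: "{a, e} \<in> edges G" "{c, e} \<in> edges G" "{a, e} \<in> B \<or> {c, e} \<in> B"
    using not_thin_insertD[OF G thin tri(2)] max none by metis
  obtain f where f: "{b, f} \<in> edges G" "{c, f} \<in> edges G" "{b, f} \<in> B \<or> {c, f} \<in> B"
    using not_thin_insertD[OF G thin tri(3)] max none by metis
  \<comment> \<open>If \<open>d = c\<close>, then \<open>{a, c}\<close> or \<open>{b, c}\<close>
    would be in \<open>B\<close>; likewise for \<open>e\<close> and \<open>f\<close>. This supplies
    the \<open>neq\<close> premises for both paths below.\<close>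
  have "d \<noteq> c" "e \<noteq> b" "f \<noteq> a"
    using d e f none by (auto simp: insert_commute)
  moreover from this have "d = e"
    using no_path_in_neighborhood[OF G free, of a d b c e] d e tri
    by (simp add: insert_commute)
  moreover from calculation have "d = f"
    using no_path_in_neighborhood[OF G free, of b d a c f] d f tri
    by (simp add: insert_commute)
  \<comment> \<open>Each pair among the three edges at the common apex meets \<open>B\<close>, so at
    most one of them is outside \<open>B\<close>.\<close>
  ultimately have "{d, a} \<in> B \<and> {d, b} \<in> B \<or> {d, a} \<in> B \<and> {d, c} \<in> B \<or> {d, b} \<in> B \<and> {d, c} \<in> B"
    using d e f by (auto simp: insert_commute)
  then show False
    using thin tri by (auto simp: thin_def)
qed

lemma fan_free_triangle_coloring:
  fixes G :: "'a ugraph"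
  assumes G: "simple_graph G"
    and free: "graph_free (graph_join (complete_graph 1) (path_graph 4)) G"
  obtains c :: "'a set \<Rightarrow> color"
  where "\<And>x. \<not> contains_copy (color_class G c x) (complete_graph 3)"
proof -
  obtain B where B: "thin G B" "\<And>e. thin G (insert e B) \<Longrightarrow> e \<in> B"
    using maximal_thin_exists[OF G] by blast
  define col where "col e = (if e \<in> B then Blue else Red)" for e
  have "\<not> contains_copy (color_class G col x) (complete_graph 3)" for x
  proof
    assume "contains_copy (color_class G col x) (complete_graph 3)"
    then obtain a b c where tri: "{a, b} \<in> edges G" "{a, c} \<in> edges G" "{b, c} \<in> edges G"
      and x: "col {a, b} = x" "col {a, c} = x" "col {b, c} = x"
      by (rule contains_triangleD) (auto simp: color_class_def)
    have "{a, b} \<in> B \<or> {a, c} \<in> B \<or> {b, c} \<in> B"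
      by (rule maximal_thin_meets_triangle[OF G free B tri])
    \<comment> \<open>Both colours are treated at once: an edge in \<open>B\<close> rules out red,
      so the whole triangle is blue.\<close>
    then have "{a, b} \<in> B \<and> {a, c} \<in> B"
      using x by (auto simp: col_def split: if_splits)
    then show False
      using B(1) tri(3) by (auto simp: thin_def)
  qed
  then show thesis
    by (rule that)
qed

theorem theorem8:
  "edge_folkman (complete_graph 3) (complete_graph 3)
      (graph_join (complete_graph 1) (path_graph 4)) = None
   \<and> (\<forall>G :: 'a ugraph.
        simple_graph G \<and> graph_free (graph_join (complete_graph 1) (path_graph 4)) G \<longrightarrow>
        (\<exists>c :: 'a set \<Rightarrow> color. \<forall>x. \<not> contains_copy (color_class G c x) (complete_graph 3)))"
proof
  \<comment> \<open>The colouring lemma at vertex type \<open>nat\<close> refutes every order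
    \<open>n\<close>, so \<open>edge_folkman\<close> takes its \<open>None\<close> branch.\<close>
  have "\<not> folkman_order (complete_graph 3) (complete_graph 3)
      (graph_join (complete_graph 1) (path_graph 4)) n" for n
    unfolding folkman_order_def edge_arrows_def by (metis fan_free_triangle_coloring)
  then show "edge_folkman (complete_graph 3) (complete_graph 3)
      (graph_join (complete_graph 1) (path_graph 4)) = None"
    by (simp add: edge_folkman_def)
qed (metis fan_free_triangle_coloring)

end
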